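(* For all integers $n,k>0$, $$(-1)^k \left( pod(n)+2 \sum_{j=1}^{k} (-1)^{j}\, pod\big(n-4j^2\big) - Q_0(n) \right) \geqslant 0,$$ with strict inequality if and only if $n\geqslant 4(k+1)^2$.
   Context: A partition of $n$ is a nonincreasing sequence of positive integers (called parts) with sum $n$; the empty partition is the only partition of $0$. $pod(n)$ is the number of partitions of $n$ in which odd parts are distinct and even parts are unrestricted; $pod(0)=1$ and $pod(x)=0$ if $x$ is not a nonnegative integer. $Q_0(n)$ is the number of partitions of $n$ into distinct parts none of which is congruent to $0$ modulo $4$. *)

theory Defs
  imports Main
begin

definition partitions :: "nat \<Rightarrow> nat list set" where
  "partitions n = {xs. sorted_wrt (\<ge>) xs \<and> (\<forall>x\<in>set xs. 0 < x) \<and> sum_list xs = n}"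

(* The argument is an integer, so that the convention pod(x) = 0 for negative x is available. *)
definition pod :: "int \<Rightarrow> nat" where
  "pod n = (if n < 0 then 0 else card {xs \<in> partitions (nat n). distinct (filter odd xs)})"

definition Q0 :: "nat \<Rightarrow> nat" where
  "Q0 n = card {xs \<in> partitions n. distinct xs \<and> (\<forall>x\<in>set xs. x mod 4 \<noteq> 0)}"

end

theory Submission
  imports Defs "HOL-Computational_Algebra.Formal_Power_Series"
begin

text \<open>
  The generating function of the numbers \<open>pod n\<close> is the product of
  \<open>(1 + X ^ (2i-1)) / (1 - X ^ (2i))\<close>, and Gauss's theta identity
  \[ 1 + 2 \sum_{j \ge 1} (-1)^j q^{j^2} = \prod_{i \ge 1} \frac{1 - q^i}{1 + q^i} \]
  at \<open>q = X ^ 4\<close> turns it, after multiplication, into the product of \<open>1 + X ^ i\<close> over the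
  \<open>i\<close> not divisible by 4, which generates the numbers \<open>Q0 n\<close>. Comparing coefficients,
  \<open>pod n + 2 * (\<Sum>j\<ge>1. (-1) ^ j * pod (n - 4 * j^2)) = Q0 n\<close> (lemma \<open>pod_theta_sum\<close>). The truncated
  sum in the theorem is therefore, up to sign, twice the tail
  \<open>pod (n - 4 * (k+1)^2) - pod (n - 4 * (k+2)^2) + \<dots>\<close>. Inserting an even part greater than 2 shows that
  the terms of this tail decrease, strictly as long as they are nonzero
  (\<open>pod_strict_decrease\<close>), so an alternating series argument gives the sign and the case of
  equality.

  No infinite product is needed: everything is proved for partitions whose parts are bounded by
  \<open>4 * M\<close>, modulo a power of \<open>X\<close> that grows with \<open>M\<close>. What makes this possible is an exact
  finite form of Gauss's identity (\<open>finite_gauss\<close>), valid in every commutative ring and proved by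
  telescoping.
\<close>

unbundle fps_syntax

section \<open>A finite form of Gauss's theta identity\<close>

definition theta_sum :: "nat \<Rightarrow> 'a::comm_ring_1 \<Rightarrow> 'a" where
  "theta_sum n q = 1 + 2 * (\<Sum>j=1..n. (-1) ^ j * q ^ (j^2))"

definition minus_prod :: "nat \<Rightarrow> 'a::comm_ring_1 \<Rightarrow> 'a" where
  "minus_prod n q = (\<Prod>i=1..n. 1 - q ^ i)"

definition plus_prod :: "nat \<Rightarrow> 'a::comm_ring_1 \<Rightarrow> 'a" where
  "plus_prod n q = (\<Prod>i=1..n. 1 + q ^ i)"

text \<open>
  Where division is possible this is \<open>minus_prod n q\<close> times the \<open>s\<close>-th term of the \<open>q\<close>-binomial series
  \<open>\<Sum>s. (-1;q)\<^sub>s / (q;q)\<^sub>s * z ^ s\<close> at \<open>z = - q ^ (n + 1)\<close>. The denominators are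
  cancelled so that the terms exist in every commutative ring.
\<close>

definition gauss_term :: "nat \<Rightarrow> 'a::comm_ring_1 \<Rightarrow> nat \<Rightarrow> 'a" where
  "gauss_term n q s =
     (-1) ^ s * (\<Prod>i<s. 1 + q ^ i) * (\<Prod>i\<in>{s<..n}. 1 - q ^ i) * q ^ (s * (n + 1))"

lemma theta_sum_Suc:
  "theta_sum (Suc n) q = theta_sum n q + 2 * ((-1) ^ Suc n * q ^ ((Suc n)^2))"
  by (simp add: theta_sum_def algebra_simps)

lemma minus_prod_Suc: "minus_prod (Suc n) q = (1 - q ^ Suc n) * minus_prod n q"
  by (simp add: minus_prod_def mult.commute)

lemma plus_prod_Suc: "plus_prod (Suc n) q = (1 + q ^ Suc n) * plus_prod n q"
  by (simp add: plus_prod_def mult.commute)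

lemma prod_lessThan_eq_plus_prod: "(\<Prod>i<Suc n. 1 + q ^ i) = 2 * plus_prod n q"
proof (induction n)
  case 0
  then show ?case by (simp add: plus_prod_def)
next
  case (Suc n)
  have "(\<Prod>i<Suc (Suc n). 1 + q ^ i) = (\<Prod>i<Suc n. 1 + q ^ i) * (1 + q ^ Suc n)"
    by (rule prod.lessThan_Suc)
  then show ?case unfolding Suc.IH plus_prod_Suc by (simp only: mult_ac)
qed

lemma gauss_term_Suc_left:
  assumes "s \<le> n"
  shows "gauss_term (Suc n) q s = gauss_term n q s * ((1 - q ^ Suc n) * q ^ s)"
proof -
  have "{s<..Suc n} = insert (Suc n) {s<..n}" using assms by auto
  moreover have "s * (Suc n + 1) = s * (n + 1) + s" by simp
  ultimately show ?thesis
    unfolding gauss_term_def by (simp only: power_add) simp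
qed

lemma gauss_term_Suc_right:
  assumes "s < n"
  shows "(1 - q ^ Suc s) * gauss_term n q (Suc s)
       = - ((1 + q ^ s) * q ^ Suc n * gauss_term n q s)"
proof -
  have "{s<..n} = insert (Suc s) {Suc s<..n}" using assms by auto
  moreover have "Suc s * (n + 1) = s * (n + 1) + Suc n" by simp
  ultimately show ?thesis
    unfolding gauss_term_def by (simp only: power_add) (simp add: algebra_simps)
qed

text \<open>
  Passing from \<open>n\<close> to \<open>n + 1\<close> changes the terms by a difference of consecutive values of
  \<open>(1 - q ^ s) * gauss_term n q s\<close>, so only the boundary terms survive in the sum.
\<close>

lemma gauss_term_telescope:
  assumes "m \<le> n"
  shows "(\<Sum>s\<le>m. gauss_term (Suc n) q s - (1 + q ^ Suc n) * gauss_term n q s)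
       = - ((1 + q ^ m) * q ^ Suc n * gauss_term n q m)"
  using assms
proof (induction m)
  case 0
  then show ?case by (simp add: gauss_term_Suc_left) (simp add: algebra_simps)
next
  case (Suc m)
  have "(\<Sum>s\<le>Suc m. gauss_term (Suc n) q s - (1 + q ^ Suc n) * gauss_term n q s)
      = (1 - q ^ Suc m) * gauss_term n q (Suc m)
        + (gauss_term (Suc n) q (Suc m) - (1 + q ^ Suc n) * gauss_term n q (Suc m))"
    using Suc gauss_term_Suc_right[of m n q] by simp
  also have "\<dots> = - ((1 + q ^ Suc m) * q ^ Suc n * gauss_term n q (Suc m))"
    using Suc.prems by (simp only: gauss_term_Suc_left) (simp add: algebra_simps)
  finally show ?case .
qed

lemma finite_gauss: "theta_sum n q * plus_prod n q = (\<Sum>s\<le>n. gauss_term n q s)"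
proof (induction n)
  case 0
  then show ?case by (simp add: theta_sum_def plus_prod_def gauss_term_def)
next
  case (Suc n)
  define c where "c = (-1) ^ Suc n * (\<Prod>i<Suc n. 1 + q ^ i) * q ^ ((Suc n)^2)"
  have "(1 + q ^ n) * q ^ Suc n * gauss_term n q n = - c"
  proof -
    have "(Suc n)^2 = n * (n + 1) + Suc n" by (simp add: power2_eq_square)
    then show ?thesis
      unfolding gauss_term_def c_def by (simp only: power_add) (simp add: algebra_simps)
  qed
  then have "(\<Sum>s\<le>n. gauss_term (Suc n) q s) = (1 + q ^ Suc n) * (\<Sum>s\<le>n. gauss_term n q s) + c"
    using gauss_term_telescope[of n n q]
    unfolding sum_subtractf sum_distrib_left[symmetric] by (simp only: algebra_simps) simp
  moreover have "gauss_term (Suc n) q (Suc n) = q ^ Suc n * c"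
  proof -
    have "Suc n * (Suc n + 1) = Suc n + (Suc n)^2" by (simp add: power2_eq_square)
    then show ?thesis
      unfolding gauss_term_def c_def by (simp only: power_add) (simp add: mult_ac)
  qed
  ultimately have "(\<Sum>s\<le>Suc n. gauss_term (Suc n) q s)
      = (1 + q ^ Suc n) * (theta_sum n q * plus_prod n q) + (1 + q ^ Suc n) * c"
    using Suc.IH by (simp add: algebra_simps)
  also have "\<dots> = theta_sum (Suc n) q * plus_prod (Suc n) q"
    unfolding prod_lessThan_eq_plus_prod theta_sum_Suc plus_prod_Suc c_def
    by (simp only: algebra_simps)
  finally show ?case by simp
qed

text \<open>
  In the finite identity the term for \<open>s = 0\<close> is \<open>minus_prod n q\<close>, and every other term carries
  the factor \<open>q ^ (s * (n + 1))\<close>.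
\<close>

lemma gauss_dvd:
  "q ^ Suc n dvd theta_sum n q * plus_prod n q - minus_prod n q"
proof -
  have "gauss_term n q 0 = minus_prod n q"
  proof -
    have "{0<..n} = {1..n}" by auto
    then show ?thesis by (simp add: gauss_term_def minus_prod_def)
  qed
  moreover have "(\<Sum>s\<le>n. gauss_term n q s) = gauss_term n q 0 + (\<Sum>s=1..n. gauss_term n q s)"
    by (simp add: atMost_atLeast0 sum.atLeast_Suc_atMost)
  moreover
  have "q ^ Suc n dvd gauss_term n q s" if "s \<in> {1..n}" for s
  proof -
    have "Suc n \<le> s * (n + 1)" using that by (cases s) auto
    then show ?thesis
      unfolding gauss_term_def by (intro dvd_mult le_imp_power_dvd)
  qed
  then have "q ^ Suc n dvd (\<Sum>s=1..n. gauss_term n q s)"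
    by (rule dvd_sum)
  ultimately show ?thesis
    unfolding finite_gauss by simp
qed

lemma minus_prod_tail_dvd: "q ^ Suc n dvd minus_prod (n + m) q - minus_prod n q"
proof (induction m)
  case 0
  then show ?case by simp
next
  case (Suc m)
  have "minus_prod (n + Suc m) q - minus_prod n q
      = (minus_prod (n + m) q - minus_prod n q) - q ^ Suc n * (q ^ m * minus_prod (n + m) q)"
    by (simp add: minus_prod_Suc algebra_simps power_add)
  then show ?case
    using Suc by (metis dvd_diff dvd_triv_left)
qed

section \<open>Generating functions of partitions with bounded parts\<close>

text \<open>
  Partitions with parts in \<open>{x. A x \<and> x \<le> N}\<close> in which the parts satisfying \<open>D\<close> are distinct. Both
  counting functions of the theorem are of this form, and the bound \<open>N\<close> gives a parameter for
  induction.
\<close>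

definition bounded_partitions :: "(nat \<Rightarrow> bool) \<Rightarrow> (nat \<Rightarrow> bool) \<Rightarrow> nat \<Rightarrow> nat \<Rightarrow> nat list set" where
  "bounded_partitions D A N n =
     {xs \<in> partitions n. distinct (filter D xs) \<and> (\<forall>x\<in>set xs. A x \<and> x \<le> N)}"

definition partition_gf :: "(nat \<Rightarrow> bool) \<Rightarrow> (nat \<Rightarrow> bool) \<Rightarrow> nat \<Rightarrow> int fps" where
  "partition_gf D A N = Abs_fps (\<lambda>n. int (card (bounded_partitions D A N n)))"

lemma partitions_part_le: "xs \<in> partitions n \<Longrightarrow> x \<in> set xs \<Longrightarrow> x \<le> n"
  by (auto simp: partitions_def member_le_sum_list)

lemma partitions_length_le: "xs \<in> partitions n \<Longrightarrow> length xs \<le> n"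
proof -
  have "\<forall>x\<in>set xs. 0 < x \<Longrightarrow> length xs \<le> sum_list xs" for xs :: "nat list"
    by (induction xs) auto
  then show "xs \<in> partitions n \<Longrightarrow> length xs \<le> n"
    by (auto simp: partitions_def)
qed

lemma finite_partitions: "finite (partitions n)"
proof (rule finite_subset)
  show "partitions n \<subseteq> {xs. set xs \<subseteq> {..n} \<and> length xs \<le> n}"
    using partitions_part_le partitions_length_le by auto
qed (simp add: finite_lists_length_le)

lemma finite_bounded_partitions: "finite (bounded_partitions D A N n)"
  unfolding bounded_partitions_def using finite_partitions by simp

lemma bounded_partitions_0:
  "bounded_partitions D A 0 n = (if n = 0 then {[]} else {})"
proof -
  have "xs = []" if "xs \<in> bounded_partitions D A 0 n" for xs
    using that by (cases xs) (auto simp: bounded_partitions_def partitions_def)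
  then have "bounded_partitions D A 0 n \<subseteq> {[]}" by blast
  moreover have "[] \<in> bounded_partitions D A 0 n \<longleftrightarrow> n = 0"
    by (auto simp: bounded_partitions_def partitions_def)
  ultimately show ?thesis by auto
qed

lemma partition_gf_0: "partition_gf D A 0 = 1"
  by (rule fps_ext) (simp add: partition_gf_def bounded_partitions_0)

lemma partition_gf_Suc_excluded:
  assumes "\<not> A (Suc N)"
  shows "partition_gf D A (Suc N) = partition_gf D A N"
proof -
  have "bounded_partitions D A (Suc N) n = bounded_partitions D A N n" for n
    using assms le_Suc_eq by (auto simp: bounded_partitions_def)
  then show ?thesis by (simp add: partition_gf_def)
qed

text \<open>
  Partitions are nonincreasing lists, so a part equal to the bound \<open>Suc N\<close> can only be split off at
  the head. If such parts must be distinct, the rest has smaller parts; otherwise the rest is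
  arbitrary.
\<close>

lemma bounded_partitions_Suc:
  assumes "A (Suc N)"
  shows "bounded_partitions D A (Suc N) n = bounded_partitions D A N n \<union>
    (if n < Suc N then {}
     else (#) (Suc N) ` bounded_partitions D A (if D (Suc N) then N else Suc N) (n - Suc N))"
    (is "?L = ?R")
proof (rule set_eqI)
  fix xs
  show "xs \<in> ?L \<longleftrightarrow> xs \<in> ?R"
  proof (cases "\<exists>ys. xs = Suc N # ys")
    case True
    then obtain ys where xs: "xs = Suc N # ys" by blast
    have bound: "(\<forall>x\<in>set ys. x \<le> N) \<longleftrightarrow> (\<forall>x\<in>set ys. x \<le> Suc N) \<and> Suc N \<notin> set ys"
      using le_Suc_eq by auto
    have "xs \<in> ?L \<longleftrightarrow> \<not> n < Suc N \<and>
        ys \<in> bounded_partitions D A (if D (Suc N) then N else Suc N) (n - Suc N)"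
      using assms bound by (auto simp: xs bounded_partitions_def partitions_def)
    then show ?thesis
      by (auto simp: xs bounded_partitions_def)
  next
    case False
    have "x \<le> N" if "xs \<in> ?L" "x \<in> set xs" for x
    proof (cases xs)
      case (Cons y ys)
      with that False have "y \<le> N" "x \<le> y"
        by (auto simp: bounded_partitions_def partitions_def le_Suc_eq)
      then show ?thesis by simp
    qed (use that in simp)
    then have "xs \<in> ?L \<longleftrightarrow> xs \<in> bounded_partitions D A N n"
      by (auto simp: bounded_partitions_def intro: le_SucI)
    then show ?thesis using False by auto
  qed
qed

lemma partition_gf_Suc:
  assumes "A (Suc N)"
  shows "partition_gf D A (Suc N) = partition_gf D A N +
    fps_X ^ Suc N * partition_gf D A (if D (Suc N) then N else Suc N)"
proof (rule fps_ext)
  fix n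
  let ?N = "if D (Suc N) then N else Suc N"
  have "card (bounded_partitions D A (Suc N) n) = card (bounded_partitions D A N n) +
      (if n < Suc N then 0 else card (bounded_partitions D A ?N (n - Suc N)))"
  proof -
    have "bounded_partitions D A N n \<inter> (#) (Suc N) ` S = {}" for S
      by (auto simp: bounded_partitions_def)
    then show ?thesis
      unfolding bounded_partitions_Suc[of A, OF assms]
      by (simp add: card_Un_disjoint finite_bounded_partitions card_image)
  qed
  then show "partition_gf D A (Suc N) $ n =
      (partition_gf D A N + fps_X ^ Suc N * partition_gf D A ?N) $ n"
    unfolding partition_gf_def fps_add_nth fps_X_power_mult_nth by simp
qed

lemma partition_gf_Suc_distinct:
  assumes "A (Suc N)" "D (Suc N)"
  shows "partition_gf D A (Suc N) = (1 + fps_X ^ Suc N) * partition_gf D A N"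
  using partition_gf_Suc[of A N D] assms by (simp add: algebra_simps)

lemma partition_gf_Suc_repeatable:
  assumes "A (Suc N)" "\<not> D (Suc N)"
  shows "(1 - fps_X ^ Suc N) * partition_gf D A (Suc N) = partition_gf D A N"
  using partition_gf_Suc[of A N D] assms by (simp add: algebra_simps)

lemma bounded_partitions_unbounded:
  assumes "n \<le> N"
  shows "bounded_partitions D A N n =
    {xs \<in> partitions n. distinct (filter D xs) \<and> (\<forall>x\<in>set xs. A x)}"
  using assms partitions_part_le order.trans unfolding bounded_partitions_def by blast

abbreviation pod_gf :: "nat \<Rightarrow> int fps" where
  "pod_gf \<equiv> partition_gf odd (\<lambda>_. True)"

abbreviation Q0_gf :: "nat \<Rightarrow> int fps" where
  "Q0_gf \<equiv> partition_gf (\<lambda>_. True) (\<lambda>x. x mod 4 \<noteq> 0)"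

lemma pod_gf_nth: "n \<le> N \<Longrightarrow> pod_gf N $ n = int (pod (int n))"
  by (simp add: partition_gf_def pod_def bounded_partitions_unbounded)

lemma Q0_gf_nth: "n \<le> N \<Longrightarrow> Q0_gf N $ n = int (Q0 n)"
  by (simp add: partition_gf_def Q0_def bounded_partitions_unbounded)

text \<open>
  The odd parts are distinct in both counting problems, so this factor is common to the two
  generating functions. The bound on the parts grows in steps of 4, so that every step meets each
  residue class modulo 4 once.
\<close>

definition odd_prod :: "nat \<Rightarrow> int fps" where
  "odd_prod M = (\<Prod>i<M. (1 + fps_X ^ (4 * i + 1)) * (1 + fps_X ^ (4 * i + 3)))"

lemma pod_gf_prod:
  "pod_gf (4 * M) * ((\<Prod>i<M. 1 - fps_X ^ (4 * i + 2)) * minus_prod M (fps_X ^ 4)) = odd_prod M"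
proof (induction M)
  case 0
  then show ?case by (simp add: partition_gf_0 minus_prod_def odd_prod_def)
next
  case (Suc M)
  have *: "4 * Suc M = Suc (4 * M + 3)" "4 * M + 3 = Suc (4 * M + 2)"
    "4 * M + 2 = Suc (4 * M + 1)" "4 * M + 1 = Suc (4 * M)"
    by simp_all
  let ?E = "\<Prod>i<M. 1 - fps_X ^ (4 * i + 2) :: int fps"
  let ?B = "minus_prod M (fps_X ^ 4) :: int fps"
  have B: "minus_prod (Suc M) (fps_X ^ 4) = (1 - fps_X ^ (4 * Suc M)) * ?B"
    unfolding minus_prod_Suc power_mult ..
  have s4: "(1 - fps_X ^ (4 * Suc M)) * pod_gf (4 * Suc M) = pod_gf (4 * M + 3)"
    unfolding *(1) by (rule partition_gf_Suc_repeatable) simp_all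
  have s3: "pod_gf (4 * M + 3) = (1 + fps_X ^ (4 * M + 3)) * pod_gf (4 * M + 2)"
    unfolding *(2) by (rule partition_gf_Suc_distinct) simp_all
  have s2: "(1 - fps_X ^ (4 * M + 2)) * pod_gf (4 * M + 2) = pod_gf (4 * M + 1)"
    unfolding *(3) by (rule partition_gf_Suc_repeatable) simp_all
  have s1: "pod_gf (4 * M + 1) = (1 + fps_X ^ (4 * M + 1)) * pod_gf (4 * M)"
    unfolding *(4) by (rule partition_gf_Suc_distinct) simp_all
  have "pod_gf (4 * Suc M) *
      ((\<Prod>i<Suc M. 1 - fps_X ^ (4 * i + 2)) * minus_prod (Suc M) (fps_X ^ 4))
      = ((1 - fps_X ^ (4 * Suc M)) * pod_gf (4 * Suc M)) * (1 - fps_X ^ (4 * M + 2)) * (?E * ?B)"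
    unfolding B prod.lessThan_Suc by (simp only: mult_ac)
  also have "\<dots> = (1 + fps_X ^ (4 * M + 3)) *
      ((1 - fps_X ^ (4 * M + 2)) * pod_gf (4 * M + 2)) * (?E * ?B)"
    unfolding s4 s3 by (simp only: mult_ac)
  also have "\<dots> = (1 + fps_X ^ (4 * M + 3)) * (1 + fps_X ^ (4 * M + 1)) *
      (pod_gf (4 * M) * (?E * ?B))"
    unfolding s2 s1 by (simp only: mult_ac)
  also have "\<dots> = odd_prod (Suc M)"
    unfolding Suc.IH odd_prod_def prod.lessThan_Suc by (simp only: mult_ac)
  finally show ?case .
qed

lemma Q0_gf_prod: "Q0_gf (4 * M) = odd_prod M * (\<Prod>i<M. 1 + fps_X ^ (4 * i + 2))"
proof (induction M)
  case 0
  then show ?case by (simp add: partition_gf_0 odd_prod_def)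
next
  case (Suc M)
  have *: "4 * Suc M = Suc (4 * M + 3)" "4 * M + 3 = Suc (4 * M + 2)"
    "4 * M + 2 = Suc (4 * M + 1)" "4 * M + 1 = Suc (4 * M)"
    by simp_all
  have m: "(4 * M + 3) mod 4 \<noteq> 0" "(4 * M + 2) mod 4 \<noteq> 0" "(4 * M + 1) mod 4 \<noteq> 0"
    by presburger+
  have s4: "Q0_gf (4 * Suc M) = Q0_gf (4 * M + 3)"
    unfolding *(1) by (rule partition_gf_Suc_excluded) (metis *(1) mod_mult_self1_is_0)
  have s3: "Q0_gf (4 * M + 3) = (1 + fps_X ^ (4 * M + 3)) * Q0_gf (4 * M + 2)"
    using m(1) unfolding *(2) by (intro partition_gf_Suc_distinct) simp_all
  have s2: "Q0_gf (4 * M + 2) = (1 + fps_X ^ (4 * M + 2)) * Q0_gf (4 * M + 1)"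
    using m(2) unfolding *(3) by (intro partition_gf_Suc_distinct) simp_all
  have s1: "Q0_gf (4 * M + 1) = (1 + fps_X ^ (4 * M + 1)) * Q0_gf (4 * M)"
    using m(3) unfolding *(4) by (intro partition_gf_Suc_distinct) simp_all
  show ?case
    unfolding s4 s3 s2 s1 Suc.IH odd_prod_def prod.lessThan_Suc by (simp only: mult_ac)
qed

text \<open>Each factor on the right arises from \<open>1 - y^2 = (1 - y) * (1 + y)\<close>.\<close>

lemma minus_prod_double:
  fixes x :: "'a::comm_ring_1"
  shows "(\<Prod>i<M. 1 - x ^ (4 * i + 2)) * (\<Prod>i<M. 1 + x ^ (4 * i + 2)) *
    (minus_prod M (x ^ 4) * plus_prod M (x ^ 4)) = minus_prod (2 * M) (x ^ 4)"
proof (induction M)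
  case 0
  then show ?case by (simp add: minus_prod_def plus_prod_def)
next
  case (Suc M)
  have square: "1 - y ^ 2 = (1 - y) * (1 + y)" for y :: 'a
    by (simp add: algebra_simps power2_eq_square)
  have "2 * Suc M = Suc (Suc (2 * M))" by simp
  then have "minus_prod (2 * Suc M) (x ^ 4) =
      (1 - (x ^ 4) ^ Suc (Suc (2 * M))) * ((1 - (x ^ 4) ^ Suc (2 * M)) * minus_prod (2 * M) (x ^ 4))"
    by (simp only: minus_prod_Suc)
  also have "(x ^ 4) ^ Suc (Suc (2 * M)) = ((x ^ 4) ^ Suc M) ^ 2"
    unfolding power_mult[symmetric] by (rule arg_cong[where f = "\<lambda>m. x ^ m"]) simp
  also have "(x ^ 4) ^ Suc (2 * M) = (x ^ (4 * M + 2)) ^ 2"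
    unfolding power_mult[symmetric] by (rule arg_cong[where f = "\<lambda>m. x ^ m"]) simp
  finally show ?case
    unfolding Suc.IH[symmetric] square prod.lessThan_Suc minus_prod_Suc plus_prod_Suc
    by (simp only: mult_ac)
qed

lemma fps_X_power_dvd_nth:
  fixes f :: "'a::comm_ring_1 fps"
  assumes "fps_X ^ m dvd f" "i < m"
  shows "f $ i = 0"
  using assms by (auto simp: dvd_def fps_X_power_mult_nth)

lemma fps_prod_nth_0: "(\<Prod>i\<in>S. f i) $ 0 = (\<Prod>i\<in>S. f i $ 0)"
  for f :: "'b \<Rightarrow> 'a::comm_ring_1 fps"
  by (induction S rule: infinite_finite_induct) simp_all

lemma fps_nth_zero_cancel:
  fixes u d :: "'a::comm_ring_1 fps"
  assumes "u $ 0 = 1" and "\<And>i. i < m \<Longrightarrow> (u * d) $ i = 0" and "n < m"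
  shows "d $ n = 0"
  using \<open>n < m\<close>
proof (induction n rule: less_induct)
  case (less n)
  have "0 = (\<Sum>i=0..n. u $ i * d $ (n - i))"
    using assms(2)[of n] less.prems by (simp add: fps_mult_nth)
  also have "\<dots> = (\<Sum>i=0..n. if i = 0 then d $ n else 0)"
    using less assms(1) by (intro sum.cong) auto
  finally show ?case by simp
qed

text \<open>
  The difference of the two sides is multiplied by the denominators of all products involved. That
  factor has constant term 1, so it does not affect the vanishing of the low coefficients.
\<close>

lemma pod_gf_theta_nth:
  assumes "n \<le> 4 * M"
  shows "(pod_gf (4 * M) * theta_sum M (fps_X ^ 4)) $ n = Q0_gf (4 * M) $ n"
proof -
  let ?x = "fps_X :: int fps"
  let ?E = "\<Prod>i<M. 1 - ?x ^ (4 * i + 2)"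
  let ?H = "\<Prod>i<M. 1 + ?x ^ (4 * i + 2)"
  let ?A = "plus_prod M (?x ^ 4)"
  let ?B = "minus_prod M (?x ^ 4)"
  let ?T = "theta_sum M (?x ^ 4)"
  let ?P = "pod_gf (4 * M)" and ?Q = "Q0_gf (4 * M)"
  let ?u = "?E * ?B * ?A" and ?d = "?P * ?T - ?Q"
  have "?u * ?d = (?P * (?E * ?B)) * (?T * ?A) - ?Q * (?E * ?B * ?A)"
    by (simp only: algebra_simps)
  also have "?Q * (?E * ?B * ?A) = odd_prod M * (?E * ?H * (?B * ?A))"
    unfolding Q0_gf_prod by (simp only: mult_ac)
  also have "\<dots> = odd_prod M * minus_prod (2 * M) (?x ^ 4)"
    unfolding minus_prod_double ..
  also have "?P * (?E * ?B) = odd_prod M"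
    by (rule pod_gf_prod)
  finally have "?u * ?d =
      odd_prod M * (?T * ?A) - odd_prod M * minus_prod (M + M) (?x ^ 4)"
    unfolding mult_2 .
  also have "\<dots> = odd_prod M * ((?T * ?A - ?B) - (minus_prod (M + M) (?x ^ 4) - ?B))"
    by (simp only: right_diff_distrib diff_diff_eq2 diff_add_cancel)
  finally have "?u * ?d = \<dots>" .
  then have dvd: "?x ^ (4 * Suc M) dvd ?u * ?d"
    unfolding power_mult
    using gauss_dvd[of "?x ^ 4" M] minus_prod_tail_dvd[of "?x ^ 4" M M]
    by (metis dvd_diff dvd_mult)
  have const: "?u $ 0 = 1"
    unfolding minus_prod_def plus_prod_def by (simp add: fps_prod_nth_0 flip: power_mult)
  have "?d $ n = 0"
  proof (rule fps_nth_zero_cancel[OF const])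
    show "(?u * ?d) $ i = 0" if "i < 4 * Suc M" for i
      by (rule fps_X_power_dvd_nth[OF dvd that])
    show "n < 4 * Suc M" using assms by simp
  qed
  then show ?thesis by simp
qed

lemma pod_theta_sum:
  assumes "n \<le> M"
  shows "int (pod (int n)) + 2 * (\<Sum>j=1..M. (-1) ^ j * int (pod (int n - 4 * (int j)^2)))
    = int (Q0 n)"
proof -
  have coeff: "(pod_gf (4 * M) * ((-1) ^ j * (fps_X ^ 4) ^ (j^2))) $ n
      = (-1) ^ j * int (pod (int n - 4 * (int j)^2))" for j
  proof -
    have neg: "(-1) ^ j = fps_const ((-1) ^ j :: int)"
      by (metis fps_const_neg fps_const_1_eq_1 fps_const_power)
    have shift: "pod_gf (4 * M) * ((-1) ^ j * (fps_X ^ 4) ^ (j^2))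
        = fps_const ((-1) ^ j) * (fps_X ^ (4 * j^2) * pod_gf (4 * M))"
      unfolding neg power_mult by (simp only: mult_ac)
    have nonneg: "pod_gf (4 * M) $ (n - 4 * j^2) = int (pod (int n - 4 * (int j)^2))"
      if "4 * j^2 \<le> n"
    proof -
      have "int (n - 4 * j^2) = int n - 4 * (int j)^2"
        using that by (simp add: of_nat_diff)
      then show ?thesis using pod_gf_nth[of "n - 4 * j^2" "4 * M"] assms by simp
    qed
    have neg_arg: "pod (int n - 4 * (int j)^2) = 0" if "n < 4 * j^2"
    proof -
      have "int n < int (4 * j^2)" using that by (simp only: of_nat_less_iff)
      then show ?thesis by (simp add: pod_def)
    qed
    show ?thesis
      unfolding shift fps_mult_left_const_nth fps_X_power_mult_nth
      using nonneg neg_arg by auto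
  qed
  have "int (Q0 n) = (pod_gf (4 * M) * theta_sum M (fps_X ^ 4)) $ n"
    using assms pod_gf_theta_nth[of n M] Q0_gf_nth[of n "4 * M"] by simp
  also have "pod_gf (4 * M) * theta_sum M (fps_X ^ 4) = pod_gf (4 * M) +
      fps_const 2 * (\<Sum>j=1..M. pod_gf (4 * M) * ((-1) ^ j * (fps_X ^ 4) ^ (j^2)))"
    unfolding theta_sum_def
    by (simp add: ring_distribs sum_distrib_left mult_ac flip: numeral_fps_const)
  also have "\<dots> $ n = int (pod (int n)) +
      2 * (\<Sum>j=1..M. (-1) ^ j * int (pod (int n - 4 * (int j)^2)))"
    unfolding fps_add_nth fps_mult_left_const_nth fps_sum_nth coeff
    using assms by (simp add: pod_gf_nth)
  finally show ?thesis by simp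
qed

section \<open>Monotonicity and the alternating tail\<close>

text \<open>
  Inserting a part \<open>d\<close> maps the partitions of \<open>n - d\<close> injectively into those of \<open>n\<close>. The
  partition of \<open>n\<close> into parts 2 and at most one part 1 is not in the image, as \<open>d\<close> is even and
  not 2.
\<close>

lemma pod_strict_decrease:
  assumes "even d" "2 < d"
  shows "pod (int n - int d) < pod (int n)"
proof -
  let ?pod = "\<lambda>n. {xs \<in> partitions n. distinct (filter odd xs)}"
  let ?w = "replicate (n div 2) 2 @ replicate (n mod 2) 1"
  have fin: "finite (?pod n)" using finite_partitions by simp
  have sum: "n div 2 * 2 + n mod 2 = n" by simp
  have w: "?w \<in> ?pod n"
  proof -
    have "distinct (replicate (n mod 2) (Suc 0))" by (cases "even n") (auto simp: odd_iff_mod_2_eq_one)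
    moreover have "sorted_wrt (\<ge>) (replicate m x)" for m and x :: nat
      by (induction m) auto
    ultimately show ?thesis
      using sum by (auto simp: partitions_def sorted_wrt_append sum_list_replicate filter_replicate)
  qed
  show ?thesis
  proof (cases "n < d")
    case True
    then have "pod (int n - int d) = 0" by (simp add: pod_def)
    moreover have "0 < card (?pod n)" using w fin card_gt_0_iff by blast
    ultimately show ?thesis by (simp add: pod_def)
  next
    case False
    define ins where "ins xs = rev (insort d (rev xs))" for xs :: "nat list"
    have mset_ins: "mset (ins xs) = add_mset d (mset xs)" for xs
      by (simp add: ins_def)
    have set_ins: "set (ins xs) = insert d (set xs)" for xs
      by (simp add: ins_def set_insort_key)
    have sorted_rev: "sorted_wrt (\<ge>) xs \<longleftrightarrow> sorted (rev xs)" for xs :: "nat list"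
      by (simp add: sorted_wrt_rev)
    have inj: "inj_on ins (?pod (n - d))"
    proof (rule inj_onI)
      fix xs ys assume "xs \<in> ?pod (n - d)" "ys \<in> ?pod (n - d)" "ins xs = ins ys"
      then have "mset (rev xs) = mset (rev ys)" "sorted (rev xs)" "sorted (rev ys)"
        using mset_ins[of xs] mset_ins[of ys] by (auto simp: partitions_def sorted_rev)
      then show "xs = ys"
        by (metis properties_for_sort rev_is_rev_conv)
    qed
    have "ins xs \<in> ?pod n" if "xs \<in> ?pod (n - d)" for xs
    proof -
      have "sorted_wrt (\<ge>) (ins xs)"
        using that by (auto simp: partitions_def sorted_rev ins_def sorted_insort)
      moreover have "sum_list (ins xs) = n"
        using that False mset_ins[of xs]
        by (simp add: partitions_def flip: sum_mset_sum_list)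
      moreover have "distinct (filter odd (ins xs))"
      proof -
        have "mset (filter odd (ins xs)) = mset (filter odd xs)"
          using assms(1) by (simp add: mset_ins)
        then show ?thesis using that mset_eq_imp_distinct_iff by blast
      qed
      ultimately show ?thesis
        using that assms(2) by (auto simp: partitions_def set_ins)
    qed
    moreover have "?w \<notin> ins ` ?pod (n - d)"
    proof
      assume "?w \<in> ins ` ?pod (n - d)"
      then obtain xs where "?w = ins xs" by blast
      then have "d \<in> set ?w" using set_ins[of xs] by (simp only: insertI1)
      then show False using assms(2) by auto
    qed
    ultimately have "ins ` ?pod (n - d) \<subset> ?pod n" using w by blast
    from psubset_card_mono[OF fin this] have "card (?pod (n - d)) < card (?pod n)"
      unfolding card_image[OF inj] .
    then show ?thesis using False by (simp add: pod_def nat_diff_distrib)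
  qed
qed

lemma alternating_sum_bounds:
  fixes a :: "nat \<Rightarrow> int"
  assumes "\<And>i. 0 \<le> a i" "\<And>i. a (Suc i) \<le> a i"
  shows "0 \<le> (\<Sum>i<m. (-1) ^ i * a i) \<and> (\<Sum>i<m. (-1) ^ i * a i) \<le> a 0"
  using assms
proof (induction m arbitrary: a)
  case 0
  then show ?case by simp
next
  case (Suc m)
  have "0 \<le> (\<Sum>i<m. (-1) ^ i * a (Suc i)) \<and> (\<Sum>i<m. (-1) ^ i * a (Suc i)) \<le> a (Suc 0)"
    using Suc.IH[of "\<lambda>i. a (Suc i)"] Suc.prems by simp
  moreover have "(\<Sum>i<Suc m. (-1) ^ i * a i) = a 0 - (\<Sum>i<m. (-1) ^ i * a (Suc i))"
    unfolding sum.lessThan_Suc_shift by (simp add: sum_negf)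
  ultimately show ?case using Suc.prems(2)[of 0] by linarith
qed

theorem corollary4p2:
  fixes n k :: nat
  assumes "n > 0" and "k > 0"
  shows "let T = (-1) ^ k * (int (pod (int n))
             + 2 * (\<Sum>j=1..k. (-1) ^ j * int (pod (int n - 4 * (int j)^2))) - int (Q0 n))
         in T \<ge> 0 \<and> (T > 0 \<longleftrightarrow> n \<ge> 4 * (k + 1)^2)"
proof -
  define b where "b j = int (pod (int n - 4 * (int j)^2))" for j
  define a where "a i = b (k + 1 + i)" for i
  define T where "T = (-1) ^ k * (int (pod (int n)) + 2 * (\<Sum>j=1..k. (-1) ^ j * b j) - int (Q0 n))"
  have b_zero: "b j = 0" if "n < 4 * j^2" for j
  proof -
    have "int n < int (4 * j^2)" using that by (simp only: of_nat_less_iff)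
    then show ?thesis by (simp add: b_def pod_def)
  qed
  have b_strict: "b (Suc j) < b j" if "4 * j^2 \<le> n" "0 < j" for j
  proof -
    \<comment> \<open>Consecutive arguments differ by \<open>4 * (j + 1)^2 - 4 * j^2 = 8 * j + 4\<close>.\<close>
    have "pod (int (n - 4 * j^2) - int (8 * j + 4)) < pod (int (n - 4 * j^2))"
      by (rule pod_strict_decrease) auto
    moreover have "int (n - 4 * j^2) = int n - 4 * (int j)^2"
      using that(1) by (simp add: of_nat_diff)
    moreover have "int n - 4 * (int j)^2 - int (8 * j + 4) = int n - 4 * (int (Suc j))^2"
      by (simp add: power2_eq_square algebra_simps)
    ultimately show ?thesis unfolding b_def by (metis of_nat_less_iff)
  qed
  have a_nonneg: "0 \<le> a i" for i by (simp add: a_def b_def)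
  have a_mono: "a (Suc i) \<le> a i" for i
  proof (cases "4 * (k + 1 + i)^2 \<le> n")
    case True
    then show ?thesis using b_strict[of "k + 1 + i"] by (simp add: a_def)
  next
    case False
    have "(k + 1 + i)^2 \<le> (k + 1 + Suc i)^2" by (rule power_mono) auto
    with False have "n < 4 * (k + 1 + Suc i)^2" by linarith
    then show ?thesis using b_zero a_nonneg[of i] by (simp add: a_def)
  qed
  \<comment> \<open>Summing up to \<open>k + n + 1\<close> includes all nonzero terms and leaves the first term of the tail
    to be split off.\<close>
  have "T = 2 * (\<Sum>i<Suc n. (-1) ^ i * a i)"
  proof -
    have "(\<Sum>j=1..k + Suc n. (-1) ^ j * b j)
        = (\<Sum>j=1..k. (-1) ^ j * b j) + (\<Sum>j=k+1..k + Suc n. (-1) ^ j * b j)"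
      by (rule sum.ub_add_nat) simp
    also have "(\<Sum>j=k+1..k + Suc n. (-1) ^ j * b j) = (\<Sum>i<Suc n. (-1) ^ (k + 1 + i) * a i)"
      by (rule sum.reindex_bij_witness[of _ "\<lambda>i. k + 1 + i" "\<lambda>j. j - (k + 1)"])
        (auto simp: a_def)
    also have "\<dots> = - ((-1) ^ k * (\<Sum>i<Suc n. (-1) ^ i * a i))"
      unfolding sum_distrib_left sum_negf[symmetric]
      by (rule sum.cong) (simp_all add: power_add)
    finally have "int (pod (int n)) + 2 * (\<Sum>j=1..k. (-1) ^ j * b j) - int (Q0 n)
        = 2 * ((-1) ^ k * (\<Sum>i<Suc n. (-1) ^ i * a i))"
      using pod_theta_sum[of n "k + Suc n"] unfolding b_def[symmetric] by simp
    then have "T = 2 * (((-1) ^ k * (-1) ^ k) * (\<Sum>i<Suc n. (-1) ^ i * a i))"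
      unfolding T_def by (simp only: mult_ac)
    also have "(-1) ^ k * (-1) ^ k = (1 :: int)"
      by (simp flip: power_mult_distrib)
    finally show ?thesis by simp
  qed
  also have "(\<Sum>i<Suc n. (-1) ^ i * a i) = a 0 - (\<Sum>i<n. (-1) ^ i * a (Suc i))"
    unfolding sum.lessThan_Suc_shift by (simp add: sum_negf)
  finally have T: "T = 2 * (a 0 - (\<Sum>i<n. (-1) ^ i * a (Suc i)))" .
  have tail: "0 \<le> (\<Sum>i<n. (-1) ^ i * a (Suc i)) \<and> (\<Sum>i<n. (-1) ^ i * a (Suc i)) \<le> a 1"
    using alternating_sum_bounds[of "\<lambda>i. a (Suc i)" n] a_nonneg a_mono by simp
  have "0 \<le> T" using T tail a_mono[of 0] by simp
  moreover have "0 < T" if "n \<ge> 4 * (k + 1)^2"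
    using b_strict[of "k + 1"] that T tail by (simp add: a_def)
  moreover have "T = 0" if "n < 4 * (k + 1)^2"
    using b_zero[of "k + 1"] that T tail a_mono[of 0] a_nonneg[of 1] by (simp add: a_def)
  ultimately show ?thesis
    unfolding Let_def b_def[symmetric] T_def[symmetric] by (metis less_irrefl not_le)
qed

end
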